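(* Let $\rho>0$, $c>0$, and let $\{u^\nu=(w^\nu,x^\nu,\eta^\nu,\zeta^\nu)\}_{\nu\ge0}$ in $W\times X\times S$ be the infinite sequence generated by the augmented decomposition algorithm (ADA). For any integer $N>0$, define $$\tilde x_N=\frac1N\sum_{\nu=1}^N x^\nu .$$ Then for any saddle point $\hat u=(\hat w,\hat x,\hat\eta,\hat\zeta)\in W\times X\times S$ of the Lagrangian $\bar L$, $$f(\tilde x_N)+\langle\hat\eta_1,E\tilde x_N\rangle-\min P\le\frac{\|\hat u-u^0\|_G^2}{N},$$ where $\min P$ denotes the optimal value of problem (P).
   Context: Problem (P): minimize $f(x)=f_1(x_1)+\cdots+f_K(x_K)$ subject to $Ex=E_1x_1+\cdots+E_Kx_K=q$, $x_k\in X_k$ ($k=1,\dots,K$), where $x=(x_1,\dots,x_K)\in\mathbb{R}^{n_1}\times\cdots\times\mathbb{R}^{n_K}=\mathbb{R}^n$, each $f_k$ is a closed proper convex function on $\mathbb{R}^{n_k}$ (possibly nonsmooth), each $X_k\subset\mathbb{R}^{n_k}$ is a closed convex set, $X=X_1\times\cdots\times X_K$, $E=(E_1,\dots,E_K)\in\mathbb{R}^{m\times n}$, $q\in\mathbb{R}^m$. In this statement $q=0$. Standing assumption. The global minimum of (P) is attained, and $\mathrm{int}(X)\cap\mathrm{dom} f\cap\{x: Ex=q\}\neq\emptyset$ (or, alternatively, if $X$ is polyhedral, $X\cap\mathrm{int}(\mathrm{dom} f)\cap\{x:Ex=q\}\ne\emptyset$). Spaces. $W=\{w=(w_1,\dots,w_K)\in(\mathbb{R}^m)^K: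 w_1+\cdots+w_K=0\}$, $W^\perp=\{w\in(\mathbb{R}^m)^K: w_1=\cdots=w_K\}$, $P_{W^\perp}$ is the orthogonal projection onto $W^\perp$, and $S=\{(\eta,\zeta)\in(\mathbb{R}^m)^K\times W^\perp: P_{W^\perp}(\eta)=\zeta\}$. Lagrangian. For $(w,x)\in W\times X$, $(\eta,\zeta)\in S$ (with $q=0$): $\bar L(w,x,\eta,\zeta)=\sum_{j=1}^K[f_j(x_j)+\langle\eta_j,E_jx_j\rangle-\langle\eta_j,w_j\rangle]$; $\bar L=-\infty$ if $(w,x)\in W\times X$, $(\eta,\zeta)\notin S$; $\bar L=+\infty$ if $(w,x)\notin W\times X$. A saddle point of $\bar L$ is a point of $W\times X\times S$ at which $\bar L$ is minimal with respect to $(w,x)\in W\times X$ and maximal with respect to $(\eta,\zeta)\in S$. ADA (with $q=0$). Given $w^0\in W$, $x^0\in X$, $(\eta^0,\zeta^0)\in S$, put $y^0=\frac12(\eta^0+\zeta^0)\in(\mathbb{R}^m)^K$. For $\nu=0,1,2,\dots$ and $k=1,\dots,K$: $x_k^{\nu+1}=\arg\min_{x_k\in X_k}\{f_k(x_k)+\frac{\rho}{4}\|E_kx_k-w_k^\nu+\frac{2}{\rho}y_k^\nu\|_2^2+\frac{1}{2c}\|x_k-x_k^\nu\|_2^2\}$; $\eta_k^{\nu+1}=y_k^\nu+\frac{\rho}{2}[E_kx_k^{\nu+1}-w_k^\nu]$; $\zeta_k^{\nu+1}=\frac1K\sum_{j=1}^K\eta_j^{\nu+1}$; $w_k^{\nu+1}=w_k^\nu+\frac1\rho[\eta_k^{\nu+1}-\zeta_k^{\nu+1}]$;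 $y_k^{\nu+1}=\frac12[\eta_k^{\nu+1}+\zeta_k^{\nu+1}]$. Norm. $\|(w,x,\eta,\zeta)\|_G^2=\rho\|w\|^2+\frac1c\|x\|^2+\frac1\rho\|\eta\|^2+\frac1\rho\|\zeta\|^2$. *)

theory Defs
  imports "HOL-Analysis.Analysis"
begin

text \<open>
  The block structure of the vectors \<open>x = (x\<^sub>1, \<dots>, x\<^sub>K)\<close> is given by a map \<open>blk\<close> from the coordinates
  of the full space to the block indices, so that the blocks may have different sizes: block \<open>k\<close>
  has as many coordinates as there are \<open>i\<close> with \<open>blk i = k\<close>.  The space of the \<open>k\<close>-th blocks is
  the coordinate subspace \<open>block_space blk k\<close>, i.e. a block is padded with zeros to a vector of the
  full space.  With this padding the product \<open>E\<^sub>k x\<^sub>k\<close> of the \<open>k\<close>-th column block of \<open>E\<close> with \<open>x\<^sub>k\<close> is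
  \<open>E *v x\<^sub>k\<close>, and sums, norms, closedness and convexity in the \<open>k\<close>-th block space are those of the
  full space.
\<close>

definition block_space :: "('n::finite \<Rightarrow> 'k) \<Rightarrow> 'k \<Rightarrow> (real ^ 'n) set" where
  "block_space blk k = {z. \<forall>i. blk i \<noteq> k \<longrightarrow> z $ i = 0}"

definition block :: "('n::finite \<Rightarrow> 'k) \<Rightarrow> 'k \<Rightarrow> real ^ 'n \<Rightarrow> real ^ 'n" where
  "block blk k x = (\<chi> i. if blk i = k then x $ i else 0)"

definition block_product ::
  "('n::finite \<Rightarrow> 'k) \<Rightarrow> ('k \<Rightarrow> (real ^ 'n) set) \<Rightarrow> (real ^ 'n) set" where
  "block_product blk X = {x. \<forall>k. block blk k x \<in> X k}"

definition ereal_epigraph :: "'a set \<Rightarrow> ('a \<Rightarrow> ereal) \<Rightarrow> ('a \<times> real) set" where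
  "ereal_epigraph V g = {(z, t). z \<in> V \<and> g z \<le> ereal t}"

text \<open>The values of \<open>g\<close> outside of the subspace \<open>V\<close> are irrelevant.\<close>

definition closed_proper_convex_on :: "'a::real_normed_vector set \<Rightarrow> ('a \<Rightarrow> ereal) \<Rightarrow> bool" where
  "closed_proper_convex_on V g \<longleftrightarrow>
     closed (ereal_epigraph V g) \<and> convex (ereal_epigraph V g) \<and>
     (\<forall>z\<in>V. g z \<noteq> -\<infinity>) \<and> (\<exists>z\<in>V. g z \<noteq> \<infinity>)"

definition objective ::
  "('n::finite \<Rightarrow> 'k::finite) \<Rightarrow> ('k \<Rightarrow> real ^ 'n \<Rightarrow> ereal) \<Rightarrow> real ^ 'n \<Rightarrow> ereal" where
  "objective blk f x = (\<Sum>k\<in>UNIV. f k (block blk k x))"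

definition objective_dom ::
  "('n::finite \<Rightarrow> 'k::finite) \<Rightarrow> ('k \<Rightarrow> real ^ 'n \<Rightarrow> ereal) \<Rightarrow> (real ^ 'n) set" where
  "objective_dom blk f = {x. objective blk f x < \<infinity>}"

definition feasible ::
  "('n::finite \<Rightarrow> 'k) \<Rightarrow> ('k \<Rightarrow> (real ^ 'n) set) \<Rightarrow> real ^ 'n ^ 'm::finite \<Rightarrow> real ^ 'm
    \<Rightarrow> (real ^ 'n) set" where
  "feasible blk X E q = {x \<in> block_product blk X. E *v x = q}"

definition min_value ::
  "('n::finite \<Rightarrow> 'k::finite) \<Rightarrow> ('k \<Rightarrow> (real ^ 'n) set) \<Rightarrow> ('k \<Rightarrow> real ^ 'n \<Rightarrow> ereal)
    \<Rightarrow> real ^ 'n ^ 'm::finite \<Rightarrow> real ^ 'm \<Rightarrow> ereal" where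
  "min_value blk X f E q = (INF x\<in>feasible blk X E q. objective blk f x)"

definition standing_assumption ::
  "('n::finite \<Rightarrow> 'k::finite) \<Rightarrow> ('k \<Rightarrow> (real ^ 'n) set) \<Rightarrow> ('k \<Rightarrow> real ^ 'n \<Rightarrow> ereal)
    \<Rightarrow> real ^ 'n ^ 'm::finite \<Rightarrow> real ^ 'm \<Rightarrow> bool" where
  "standing_assumption blk X f E q \<longleftrightarrow>
     (\<exists>x. is_arg_min (objective blk f) (\<lambda>x. x \<in> feasible blk X E q) x) \<and>
     (interior (block_product blk X) \<inter> objective_dom blk f \<inter> {x. E *v x = q} \<noteq> {} \<or>
      polyhedron (block_product blk X) \<and>
      block_product blk X \<inter> interior (objective_dom blk f) \<inter> {x. E *v x = q} \<noteq> {})"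

definition W_space :: "(real ^ 'm::finite ^ 'k::finite) set" where
  "W_space = {w. (\<Sum>k\<in>UNIV. w $ k) = 0}"

definition W_perp :: "(real ^ 'm::finite ^ 'k::finite) set" where
  "W_perp = {w. \<forall>i j. w $ i = w $ j}"

text \<open>The orthogonal projection onto the subspace \<open>W_perp\<close> is the nearest-point map.\<close>

definition S_space :: "((real ^ 'm::finite ^ 'k::finite) \<times> (real ^ 'm ^ 'k)) set" where
  "S_space = {(\<eta>, \<zeta>). \<zeta> \<in> W_perp \<and> closest_point W_perp \<eta> = \<zeta>}"

text \<open>The Lagrangian for the right-hand side \<open>q = 0\<close>.\<close>

definition Lagrangian ::
  "('n::finite \<Rightarrow> 'k::finite) \<Rightarrow> ('k \<Rightarrow> (real ^ 'n) set) \<Rightarrow> ('k \<Rightarrow> real ^ 'n \<Rightarrow> ereal)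
    \<Rightarrow> real ^ 'n ^ 'm::finite
    \<Rightarrow> real ^ 'm ^ 'k \<Rightarrow> real ^ 'n \<Rightarrow> real ^ 'm ^ 'k \<Rightarrow> real ^ 'm ^ 'k \<Rightarrow> ereal" where
  "Lagrangian blk X f E w x \<eta> \<zeta> =
     (if (w, x) \<in> W_space \<times> block_product blk X then
        if (\<eta>, \<zeta>) \<in> S_space then
          \<Sum>j\<in>UNIV. f j (block blk j x)
            + ereal (\<eta> $ j \<bullet> (E *v block blk j x)) - ereal (\<eta> $ j \<bullet> w $ j)
        else -\<infinity>
      else \<infinity>)"

definition saddle_point ::
  "('n::finite \<Rightarrow> 'k::finite) \<Rightarrow> ('k \<Rightarrow> (real ^ 'n) set) \<Rightarrow> ('k \<Rightarrow> real ^ 'n \<Rightarrow> ereal)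
    \<Rightarrow> real ^ 'n ^ 'm::finite
    \<Rightarrow> real ^ 'm ^ 'k \<Rightarrow> real ^ 'n \<Rightarrow> real ^ 'm ^ 'k \<Rightarrow> real ^ 'm ^ 'k \<Rightarrow> bool" where
  "saddle_point blk X f E w' x' \<eta>' \<zeta>' \<longleftrightarrow>
     w' \<in> W_space \<and> x' \<in> block_product blk X \<and> (\<eta>', \<zeta>') \<in> S_space \<and>
     (\<forall>w\<in>W_space. \<forall>x\<in>block_product blk X.
        Lagrangian blk X f E w' x' \<eta>' \<zeta>' \<le> Lagrangian blk X f E w x \<eta>' \<zeta>') \<and>
     (\<forall>(\<eta>, \<zeta>)\<in>S_space.
        Lagrangian blk X f E w' x' \<eta> \<zeta> \<le> Lagrangian blk X f E w' x' \<eta>' \<zeta>')"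

text \<open>
  \<open>ADA \<rho> c blk X f E w x \<eta> \<zeta> y\<close>: the sequences are a run of the augmented decomposition algorithm
  for the right-hand side \<open>q = 0\<close>.
\<close>

definition ADA ::
  "real \<Rightarrow> real \<Rightarrow> ('n::finite \<Rightarrow> 'k::finite) \<Rightarrow> ('k \<Rightarrow> (real ^ 'n) set)
    \<Rightarrow> ('k \<Rightarrow> real ^ 'n \<Rightarrow> ereal) \<Rightarrow> real ^ 'n ^ 'm::finite
    \<Rightarrow> (nat \<Rightarrow> real ^ 'm ^ 'k) \<Rightarrow> (nat \<Rightarrow> real ^ 'n)
    \<Rightarrow> (nat \<Rightarrow> real ^ 'm ^ 'k) \<Rightarrow> (nat \<Rightarrow> real ^ 'm ^ 'k) \<Rightarrow> (nat \<Rightarrow> real ^ 'm ^ 'k) \<Rightarrow> bool" where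
  "ADA \<rho> c blk X f E w x \<eta> \<zeta> y \<longleftrightarrow>
     w 0 \<in> W_space \<and> x 0 \<in> block_product blk X \<and> (\<eta> 0, \<zeta> 0) \<in> S_space \<and>
     y 0 = (1 / 2) *\<^sub>R (\<eta> 0 + \<zeta> 0) \<and>
     (\<forall>\<nu> k.
        is_arg_min
          (\<lambda>z. f k z
             + ereal (\<rho> / 4 * (norm (E *v z - w \<nu> $ k + (2 / \<rho>) *\<^sub>R y \<nu> $ k))\<^sup>2)
             + ereal (1 / (2 * c) * (norm (z - block blk k (x \<nu>)))\<^sup>2))
          (\<lambda>z. z \<in> X k)
          (block blk k (x (Suc \<nu>))) \<and>
        \<eta> (Suc \<nu>) $ k = y \<nu> $ k + (\<rho> / 2) *\<^sub>R (E *v block blk k (x (Suc \<nu>)) - w \<nu> $ k) \<and>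
        \<zeta> (Suc \<nu>) $ k = (1 / real CARD('k)) *\<^sub>R (\<Sum>j\<in>UNIV. \<eta> (Suc \<nu>) $ j) \<and>
        w (Suc \<nu>) $ k = w \<nu> $ k + (1 / \<rho>) *\<^sub>R (\<eta> (Suc \<nu>) $ k - \<zeta> (Suc \<nu>) $ k) \<and>
        y (Suc \<nu>) $ k = (1 / 2) *\<^sub>R (\<eta> (Suc \<nu>) $ k + \<zeta> (Suc \<nu>) $ k))"

definition G_norm_sq ::
  "real \<Rightarrow> real
    \<Rightarrow> (real ^ 'm::finite ^ 'k::finite) \<times> (real ^ 'n::finite) \<times> (real ^ 'm ^ 'k) \<times> (real ^ 'm ^ 'k)
    \<Rightarrow> real" where
  "G_norm_sq \<rho> c u = (case u of (w, x, \<eta>, \<zeta>) \<Rightarrow>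
     \<rho> * (norm w)\<^sup>2 + 1 / c * (norm x)\<^sup>2 + 1 / \<rho> * (norm \<eta>)\<^sup>2 + 1 / \<rho> * (norm \<zeta>)\<^sup>2)"

definition ergodic_mean :: "(nat \<Rightarrow> 'a::real_vector) \<Rightarrow> nat \<Rightarrow> 'a" where
  "ergodic_mean x N = (1 / real N) *\<^sub>R (\<Sum>\<nu>=1..N. x \<nu>)"

end

theory Submission
  imports Defs
begin

text \<open>
  Write \<open>u = (w, x, \<eta>, \<zeta>)\<close> for an iterate, \<open>u\<^sup>+\<close> for the next one and \<open>u'\<close> for the saddle point.
  The optimality condition of the proximal subproblems has the gradient \<open>\<eta>\<^sup>+\<close> in the coupling term.
  Because \<open>w'\<close> and \<open>w\<^sup>+\<close> lie in \<open>W\<close> while \<open>\<eta>' = \<zeta>'\<close> and \<open>\<zeta>\<^sup>+\<close> lie in its orthogonal complement, it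
  becomes
  \<open>f(x\<^sup>+) + \<langle>\<eta>', E x\<^sup>+\<rangle> - f(x') \<le> \<langle>u' - u\<^sup>+, u\<^sup>+ - u\<rangle>\<^sub>G \<le> 1/2 (\<parallel>u' - u\<parallel>\<^sub>G\<^sup>2 - \<parallel>u' - u\<^sup>+\<parallel>\<^sub>G\<^sup>2)\<close>,
  which telescopes; convexity of \<open>f\<close> passes to the ergodic mean.
\<close>

section \<open>Convexity and inner-product inequalities\<close>

text \<open>Dividing by \<open>t\<close> and letting \<open>t\<close> tend to 0 from the right
  leaves only the linear coefficient.\<close>

lemma linear_coeff_nonneg:
  fixes \<alpha> \<beta> :: real
  assumes "\<And>t. 0 < t \<Longrightarrow> t \<le> 1 \<Longrightarrow> 0 \<le> t * \<alpha> + t\<^sup>2 * \<beta>"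
  shows "0 \<le> \<alpha>"
proof (rule tendsto_lowerbound)
  show "((\<lambda>t. \<alpha> + t * \<beta>) \<longlongrightarrow> \<alpha>) (at_right 0)"
    by (auto intro!: tendsto_eq_intros)
  have "0 \<le> \<alpha> + t * \<beta>" if "0 < t" "t \<le> 1" for t
  proof -
    have "0 \<le> t * (\<alpha> + t * \<beta>)"
      using assms[OF that] by (simp add: algebra_simps power2_eq_square)
    then show ?thesis
      using that by (simp add: zero_le_mult_iff)
  qed
  then show "\<forall>\<^sub>F t in at_right 0. 0 \<le> \<alpha> + t * \<beta>"
    unfolding eventually_at_right_field by (intro exI[of _ 1]) auto
qed simp

lemma norm_affine_sq:
  fixes a b :: "'a::real_inner"
  shows "(norm (a + t *\<^sub>R b))\<^sup>2 = (norm a)\<^sup>2 + 2 * t * (b \<bullet> a) + t\<^sup>2 * (norm b)\<^sup>2"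
  unfolding power2_norm_eq_inner
  by (simp add: inner_simps inner_commute power2_eq_square algebra_simps)

text \<open>Three-point identity: the two sides differ by half the squared norm of
  \<open>b - a\<close>, which is dropped.\<close>

lemma inner_diff_le_half_norm_diff:
  fixes a b d :: "'a::real_inner"
  shows "(d - b) \<bullet> (b - a) \<le> ((norm (d - a))\<^sup>2 - (norm (d - b))\<^sup>2) / 2"
proof -
  have "0 \<le> (b - a) \<bullet> (b - a)"
    by simp
  then show ?thesis
    unfolding power2_norm_eq_inner by (simp add: inner_simps inner_commute field_simps)
qed

text \<open>Jensen's inequality for extended-valued functions. The real bounds \<open>r i\<close>
  put the points \<open>(z i, r i)\<close> into the epigraph, so no arithmetic with infinite values
  arises.\<close>

lemma convex_epigraphD:
  fixes f :: "'a::real_normed_vector \<Rightarrow> ereal"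
  assumes "convex (ereal_epigraph V f)" "finite I" "\<And>i. i \<in> I \<Longrightarrow> 0 \<le> a i" "sum a I = 1"
    and "\<And>i. i \<in> I \<Longrightarrow> z i \<in> V" "\<And>i. i \<in> I \<Longrightarrow> f (z i) \<le> ereal (r i)"
  shows "f (\<Sum>i\<in>I. a i *\<^sub>R z i) \<le> ereal (\<Sum>i\<in>I. a i * r i)"
proof -
  have "(\<Sum>i\<in>I. a i *\<^sub>R (z i, r i)) \<in> ereal_epigraph V f"
    using assms by (intro convex_sum) (auto simp: ereal_epigraph_def)
  then show ?thesis
    by (simp add: ereal_epigraph_def scaleR_prod_def sum_prod)
qed

text \<open>Along the segment from \<open>p\<close> to \<open>z\<close>, convexity bounds the change
  of \<open>f\<close> linearly in \<open>t\<close>, while the squares expand exactly. Minimality at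
  \<open>p\<close> makes the first-order coefficient nonnegative; no subgradient of \<open>f\<close>
  is involved.\<close>

lemma proximal_variational_inequality:
  fixes f :: "real ^ 'n::finite \<Rightarrow> ereal" and E :: "real ^ 'n ^ 'm::finite"
  assumes f: "convex (ereal_epigraph V f)"
    and C: "convex C" "C \<subseteq> V"
    and min: "is_arg_min (\<lambda>z. f z + ereal (\<alpha> * (norm (E *v z - a))\<^sup>2)
      + ereal (\<beta> * (norm (z - b))\<^sup>2)) (\<lambda>z. z \<in> C) p"
    and p: "f p = ereal r"
    and z: "z \<in> C" "f z = ereal s"
  shows "r \<le> s + 2 * \<alpha> * ((E *v z - E *v p) \<bullet> (E *v p - a)) + 2 * \<beta> * ((z - p) \<bullet> (p - b))"
proof -
  define d where "d = z - p"
  define e where "e = E *v z - E *v p"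
  have pC: "p \<in> C"
    using min by (simp add: is_arg_min_def)
  have "0 \<le> t * (s - r + 2 * \<alpha> * (e \<bullet> (E *v p - a)) + 2 * \<beta> * (d \<bullet> (p - b)))
      + t\<^sup>2 * (\<alpha> * (norm e)\<^sup>2 + \<beta> * (norm d)\<^sup>2)" if t: "0 < t" "t \<le> 1" for t
  proof -
    define v where "v = p + t *\<^sub>R d"
    have v: "v = (1 - t) *\<^sub>R p + t *\<^sub>R z"
      by (simp add: v_def d_def algebra_simps)
    then have "v \<in> C"
      using C(1) pC z(1) t by (simp add: convex_def)
    have "(p, r) \<in> ereal_epigraph V f" "(z, s) \<in> ereal_epigraph V f"
      using p z pC C(2) by (auto simp: ereal_epigraph_def)
    then have "(1 - t) *\<^sub>R (p, r) + t *\<^sub>R (z, s) \<in> ereal_epigraph V f"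
      using f t by (intro convexD) auto
    then have "f v \<le> ereal ((1 - t) * r + t * s)"
      by (simp add: ereal_epigraph_def v scaleR_prod_def)
    have Ev: "E *v v - a = (E *v p - a) + t *\<^sub>R e"
      by (simp add: v_def e_def d_def matrix_vector_right_distrib matrix_vector_mult_diff_distrib
          matrix_vector_mult_scaleR)
    have vb: "v - b = (p - b) + t *\<^sub>R d"
      by (simp add: v_def)
    have "ereal r + ereal (\<alpha> * (norm (E *v p - a))\<^sup>2) + ereal (\<beta> * (norm (p - b))\<^sup>2)
        \<le> f v + ereal (\<alpha> * (norm (E *v v - a))\<^sup>2) + ereal (\<beta> * (norm (v - b))\<^sup>2)"
      using min \<open>v \<in> C\<close> p unfolding is_arg_min_def by (metis not_le)
    also have "\<dots> \<le> ereal ((1 - t) * r + t * s) + ereal (\<alpha> * (norm (E *v v - a))\<^sup>2)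
        + ereal (\<beta> * (norm (v - b))\<^sup>2)"
      by (intro add_right_mono) fact
    finally show ?thesis
      unfolding Ev vb norm_affine_sq by (simp add: algebra_simps)
  qed
  then have "0 \<le> s - r + 2 * \<alpha> * (e \<bullet> (E *v p - a)) + 2 * \<beta> * (d \<bullet> (p - b))"
    by (rule linear_coeff_nonneg)
  then show ?thesis
    by (simp add: d_def e_def)
qed

section \<open>The subspaces \<open>W_space\<close> and \<open>W_perp\<close>\<close>

lemma W_perp_nth: "v \<in> W_perp \<Longrightarrow> v $ i = v $ j"
  by (simp add: W_perp_def)

text \<open>All components of \<open>v\<close> agree, so any one of them can be pulled out of the
  sum. The free index \<open>i\<close> later becomes the arbitrary component of the multiplier in
  the theorem.\<close>

lemma inner_W_perp:
  assumes "v \<in> W_perp"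
  shows "v \<bullet> u = v $ i \<bullet> (\<Sum>k\<in>UNIV. u $ k)"
  unfolding inner_vec_def[of v] inner_sum_right
  using W_perp_nth[OF assms] by (intro sum.cong refl arg_cong2[where f = inner])

lemma inner_W_perp_W_space: "v \<in> W_perp \<Longrightarrow> u \<in> W_space \<Longrightarrow> v \<bullet> u = 0"
  \<comment> \<open>Any index serves here, as the component sum of \<open>u\<close> is zero.\<close>
  using inner_W_perp[of v u undefined] by (simp add: W_space_def)

lemma subspace_W_space: "subspace W_space"
  by (auto simp: subspace_def W_space_def sum.distrib scaleR_sum_right[symmetric])

lemma subspace_W_perp: "subspace W_perp"
  unfolding subspace_def W_perp_def by (simp, metis)

text \<open>The test vector carries \<open>v $ i - v $ j\<close> in component \<open>i\<close> and
  its negative in component \<open>j\<close>; its inner product with \<open>v\<close> is the squared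
  norm of that difference.\<close>

lemma orthogonal_W_space_imp_W_perp:
  assumes "\<And>u. u \<in> W_space \<Longrightarrow> v \<bullet> u = 0"
  shows "v \<in> W_perp"
  unfolding W_perp_def
proof (intro CollectI allI)
  fix i j
  define d where "d = v $ i - v $ j"
  have "(\<Sum>k\<in>UNIV. axis i d $ k) = d" for i :: 'b
    by (simp add: axis_def)
  then have "axis i d - axis j d \<in> W_space"
    by (simp add: W_space_def sum_subtractf)
  then have "d \<bullet> d = 0"
    using assms[of "axis i d - axis j d"]
    by (simp add: d_def inner_diff_right inner_diff_left inner_axis)
  then show "v $ i = v $ j"
    by (simp add: d_def)
qed

lemma S_space_W_perp_eq: "(\<eta>, \<zeta>) \<in> S_space \<Longrightarrow> \<eta> \<in> W_perp \<Longrightarrow> \<zeta> = \<eta>"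
  by (auto simp: S_space_def closest_point_self)

text \<open>Since \<open>W_perp\<close> is closed and nonempty, nearest points exist. Hence every
  \<open>\<eta>\<close> is admissible in the maximization over \<open>S_space\<close>.\<close>

lemma S_space_surj: "(\<eta>, closest_point W_perp \<eta>) \<in> S_space"
proof -
  have "closed (W_perp :: (real ^ 'a ^ 'b) set)" "W_perp \<noteq> ({} :: (real ^ 'a ^ 'b) set)"
    using closed_subspace[OF subspace_W_perp] subspace_0[OF subspace_W_perp] by auto
  then show ?thesis
    by (simp add: S_space_def closest_point_in_set)
qed

section \<open>Block decomposition and block images\<close>

text \<open>The block-diagonal operator with diagonal blocks \<open>E_k\<close>. Its value lies in
  \<open>W_space\<close> exactly when \<open>E *v x = 0\<close>.\<close>

definition block_images ::
  "('n::finite \<Rightarrow> 'k::finite) \<Rightarrow> real ^ 'n ^ 'm::finite \<Rightarrow> real ^ 'n \<Rightarrow> real ^ 'm ^ 'k" where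
  "block_images blk E x = (\<chi> k. E *v block blk k x)"

lemma linear_block: "linear (block blk k)"
  by (rule linearI) (auto simp: block_def vec_eq_iff)

lemma linear_block_images: "linear (block_images blk E)"
  by (rule linearI)
    (simp_all add: block_images_def vec_eq_iff linear_add[OF linear_block]
      linear_scale[OF linear_block] matrix_vector_right_distrib matrix_vector_mult_scaleR)

lemma sum_block:
  fixes blk :: "'n::finite \<Rightarrow> 'k::finite"
  shows "(\<Sum>k\<in>UNIV. block blk k x) = x"
  by (simp add: block_def vec_eq_iff)

lemma sum_block_images: "(\<Sum>k\<in>UNIV. block_images blk E x $ k) = E *v x"
proof -
  have "E *v x = E *v (\<Sum>k\<in>UNIV. block blk k x)"
    by (simp only: sum_block)
  also have "\<dots> = (\<Sum>k\<in>UNIV. E *v block blk k x)"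
    by (rule linear_sum[OF matrix_vector_mul_linear])
  finally show ?thesis
    by (simp only: block_images_def vec_lambda_beta)
qed

text \<open>Each coordinate belongs to exactly one block, so the blockwise inner products add up to
  the full one.\<close>

lemma sum_inner_block:
  fixes blk :: "'n::finite \<Rightarrow> 'k::finite"
  shows "(\<Sum>k\<in>UNIV. block blk k x \<bullet> block blk k z) = x \<bullet> z"
proof -
  have "(\<Sum>k\<in>UNIV. block blk k x \<bullet> block blk k z)
      = (\<Sum>k\<in>UNIV. \<Sum>i\<in>UNIV. if blk i = k then x $ i * z $ i else 0)"
    by (simp add: block_def inner_vec_def if_distrib cong: if_cong)
  also have "\<dots> = (\<Sum>i\<in>UNIV. \<Sum>k\<in>UNIV. if blk i = k then x $ i * z $ i else 0)"
    by (rule sum.swap)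
  also have "\<dots> = x \<bullet> z"
    by (simp add: inner_vec_def)
  finally show ?thesis .
qed

section \<open>Consequences of the saddle point property\<close>

lemma Lagrangian_eq:
  assumes "w \<in> W_space" "x \<in> block_product blk X" "(\<eta>, \<zeta>) \<in> S_space"
  shows "Lagrangian blk X f E w x \<eta> \<zeta>
    = objective blk f x + ereal (\<eta> \<bullet> (block_images blk E x - w))"
proof -
  \<comment> \<open>The case split covers infinite values of \<open>f j\<close>; only the real terms
    are regrouped.\<close>
  have "f j (block blk j x) + ereal (\<eta> $ j \<bullet> (E *v block blk j x)) - ereal (\<eta> $ j \<bullet> w $ j)
      = f j (block blk j x) + ereal (\<eta> $ j \<bullet> (block_images blk E x - w) $ j)" for j
    by (cases "f j (block blk j x)") (simp_all add: block_images_def inner_diff_right)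
  then show ?thesis
    using assms by (simp add: Lagrangian_def objective_def sum.distrib inner_vec_def)
qed

lemma objective_finiteD:
  assumes "\<And>k. f k (block blk k x) \<noteq> -\<infinity>" "objective blk f x < \<infinity>"
  shows "f k (block blk k x) = ereal (real_of_ereal (f k (block blk k x)))"
proof -
  have "f k (block blk k x) \<noteq> \<infinity>"
    using assms(2) by (auto simp: objective_def sum_Pinfty)
  with assms(1)[of k] show ?thesis
    by (cases "f k (block blk k x)") auto
qed

text \<open>Minimality against \<open>w = 0\<close> and a point of finite objective bounds the
  Lagrangian at the saddle point away from infinity.\<close>

lemma saddle_point_objective_finite:
  assumes "standing_assumption blk X f E 0" "saddle_point blk X f E w' x' \<eta>' \<zeta>'"
  shows "objective blk f x' < \<infinity>"
proof -
  \<comment> \<open>Both alternatives of the standing assumption yield such a point, because an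
    interior is contained in its set.\<close>
  obtain x0 where x0: "x0 \<in> block_product blk X" "objective blk f x0 < \<infinity>"
    using assms(1) interior_subset unfolding standing_assumption_def objective_dom_def by blast
  have "Lagrangian blk X f E w' x' \<eta>' \<zeta>' \<le> Lagrangian blk X f E 0 x0 \<eta>' \<zeta>'"
    using assms(2) x0(1) subspace_0[OF subspace_W_space] unfolding saddle_point_def by blast
  also have "\<dots> = objective blk f x0 + ereal (\<eta>' \<bullet> (block_images blk E x0 - 0))"
    using assms(2) x0 subspace_0[OF subspace_W_space] unfolding saddle_point_def
    by (intro Lagrangian_eq) auto
  also have "\<dots> < \<infinity>"
    using x0 by simp
  finally show ?thesis
    using assms(2) by (auto simp: saddle_point_def Lagrangian_eq)
qed

text \<open>The Lagrangian is affine in \<open>\<eta>\<close> with slope \<open>d\<close>, the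
  residual. Maximality against the step \<open>\<eta>' + d\<close> forces this slope to
  vanish.\<close>

lemma saddle_point_block_images:
  assumes "saddle_point blk X f E w' x' \<eta>' \<zeta>'" "objective blk f x' = ereal r"
  shows "block_images blk E x' = w'"
proof -
  define d where "d = block_images blk E x' - w'"
  have "Lagrangian blk X f E w' x' (\<eta>' + d) (closest_point W_perp (\<eta>' + d))
      \<le> Lagrangian blk X f E w' x' \<eta>' \<zeta>'"
    using assms(1) S_space_surj[of "\<eta>' + d"] unfolding saddle_point_def by blast
  then have "(\<eta>' + d) \<bullet> d \<le> \<eta>' \<bullet> d"
    using assms S_space_surj[of "\<eta>' + d"]
    by (simp add: saddle_point_def Lagrangian_eq d_def)
  then have "d \<bullet> d \<le> 0"
    by (simp add: inner_add_left)
  then have "d = 0"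
    by (metis inner_gt_zero_iff not_less)
  then show ?thesis
    by (simp add: d_def)
qed

text \<open>Minimality over the subspace \<open>W_space\<close>, tested with \<open>w' + u\<close>
  and \<open>w' - u\<close>, makes \<open>\<eta>'\<close> orthogonal to it.\<close>

lemma saddle_point_multiplier:
  assumes "saddle_point blk X f E w' x' \<eta>' \<zeta>'" "objective blk f x' = ereal r"
  shows "\<eta>' \<in> W_perp"
proof (rule orthogonal_W_space_imp_W_perp)
  have *: "\<eta>' \<bullet> u \<le> 0" if u: "u \<in> W_space" for u
  proof -
    have "w' + u \<in> W_space"
      using assms(1) u subspace_add[OF subspace_W_space] by (auto simp: saddle_point_def)
    moreover from this
    have "Lagrangian blk X f E w' x' \<eta>' \<zeta>' \<le> Lagrangian blk X f E (w' + u) x' \<eta>' \<zeta>'"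
      using assms(1) by (simp add: saddle_point_def)
    ultimately show ?thesis
      using assms by (simp add: saddle_point_def Lagrangian_eq inner_simps)
  qed
  show "\<eta>' \<bullet> u = 0" if "u \<in> W_space" for u
    using *[of u] *[of "- u"] that subspace_neg[OF subspace_W_space that] by simp
qed

text \<open>For feasible \<open>x\<close> the choice \<open>w = block_images blk E x\<close> is
  admissible and cancels the coupling term; at the saddle point that term vanishes as well.\<close>

lemma saddle_point_objective_le_min_value:
  assumes saddle: "saddle_point blk X f E w' x' \<eta>' \<zeta>'" and r: "objective blk f x' = ereal r"
  shows "ereal r \<le> min_value blk X f E 0"
  unfolding min_value_def
proof (rule INF_greatest)
  fix x
  assume x: "x \<in> feasible blk X E 0"
  then have "block_images blk E x \<in> W_space"
    by (simp add: W_space_def sum_block_images feasible_def)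
  moreover from this
  have "Lagrangian blk X f E w' x' \<eta>' \<zeta>' \<le> Lagrangian blk X f E (block_images blk E x) x \<eta>' \<zeta>'"
    using saddle x by (simp add: saddle_point_def feasible_def)
  ultimately show "ereal r \<le> objective blk f x"
    using saddle x r saddle_point_block_images[OF saddle r]
    by (simp add: saddle_point_def Lagrangian_eq feasible_def zero_ereal_def[symmetric])
qed

text \<open>
  One sweep of the algorithm, from \<open>(w, x, \<eta>, \<zeta>)\<close> to \<open>(w\<^sub>1, x\<^sub>1, \<eta>\<^sub>1, \<zeta>\<^sub>1)\<close>; \<open>z\<close> and \<open>z'\<close> stand for the
  block images \<open>(E\<^sub>k x\<^sub>1\<^sub>k)\<^sub>k\<close> and \<open>(E\<^sub>k x'\<^sub>k)\<^sub>k = w'\<close>.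
\<close>

lemma coupling_term_eq:
  fixes w w\<^sub>1 w' \<eta> \<zeta> \<eta>\<^sub>1 \<zeta>\<^sub>1 \<eta>' z :: "real ^ 'm::finite ^ 'k::finite"
  assumes \<rho>: "\<rho> > 0"
    and W: "w\<^sub>1 \<in> W_space" "w' \<in> W_space" "\<eta>\<^sub>1 - \<zeta>\<^sub>1 \<in> W_space"
    and W_perp: "\<zeta> \<in> W_perp" "\<zeta>\<^sub>1 \<in> W_perp" "\<eta>' \<in> W_perp"
    and z: "z = w + (1 / \<rho>) *\<^sub>R (2 *\<^sub>R \<eta>\<^sub>1 - \<eta> - \<zeta>)"
    and w\<^sub>1: "w\<^sub>1 = w + (1 / \<rho>) *\<^sub>R (\<eta>\<^sub>1 - \<zeta>\<^sub>1)"
  shows "(w' - z) \<bullet> \<eta>\<^sub>1 + \<eta>' \<bullet> z = \<rho> * ((w' - w\<^sub>1) \<bullet> (w\<^sub>1 - w))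
    + 1 / \<rho> * ((\<eta>' - \<eta>\<^sub>1) \<bullet> (\<eta>\<^sub>1 - \<eta>)) + 1 / \<rho> * ((\<eta>' - \<zeta>\<^sub>1) \<bullet> (\<zeta>\<^sub>1 - \<zeta>))"
proof -
  \<comment> \<open>Recentring at \<open>w\<^sub>1\<close> makes the increments of both
    \<open>\<eta>\<close> and \<open>\<zeta>\<close> appear.\<close>
  have z': "z = w\<^sub>1 + (1 / \<rho>) *\<^sub>R ((\<eta>\<^sub>1 - \<eta>) + (\<zeta>\<^sub>1 - \<zeta>))"
    by (simp add: z w\<^sub>1 algebra_simps scaleR_2)
  have "\<rho> *\<^sub>R (w\<^sub>1 - w) = \<eta>\<^sub>1 - \<zeta>\<^sub>1"
    using \<rho> by (simp add: w\<^sub>1)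
  then have d: "\<rho> * ((w' - w\<^sub>1) \<bullet> (w\<^sub>1 - w)) = (w' - w\<^sub>1) \<bullet> (\<eta>\<^sub>1 - \<zeta>\<^sub>1)"
    by (metis inner_scaleR_right)
  have "w' - w\<^sub>1 \<in> W_space"
    using W subspace_diff[OF subspace_W_space] by blast
  then have 1: "\<zeta>\<^sub>1 \<bullet> (w' - w\<^sub>1) = 0"
    using W_perp by (simp add: inner_W_perp_W_space)
  have 2: "\<eta>' \<bullet> w' = 0" "\<eta>' \<bullet> w\<^sub>1 = 0"
    using W W_perp by (simp_all add: inner_W_perp_W_space)
  have "\<zeta>\<^sub>1 - \<zeta> \<in> W_perp"
    using W_perp subspace_diff[OF subspace_W_perp] by blast
  then have 3: "(\<zeta>\<^sub>1 - \<zeta>) \<bullet> (\<eta>\<^sub>1 - \<zeta>\<^sub>1) = 0"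
    using W by (simp add: inner_W_perp_W_space)
  \<comment> \<open>A purely algebraic expansion; the last bracket collects the terms that
    orthogonality removes.\<close>
  have "(w' - z) \<bullet> \<eta>\<^sub>1 + \<eta>' \<bullet> z = (w' - w\<^sub>1) \<bullet> (\<eta>\<^sub>1 - \<zeta>\<^sub>1)
      + 1 / \<rho> * ((\<eta>' - \<eta>\<^sub>1) \<bullet> (\<eta>\<^sub>1 - \<eta>)) + 1 / \<rho> * ((\<eta>' - \<zeta>\<^sub>1) \<bullet> (\<zeta>\<^sub>1 - \<zeta>))
      + (\<zeta>\<^sub>1 \<bullet> (w' - w\<^sub>1) + \<eta>' \<bullet> w\<^sub>1 - 1 / \<rho> * ((\<zeta>\<^sub>1 - \<zeta>) \<bullet> (\<eta>\<^sub>1 - \<zeta>\<^sub>1)))"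
    using \<rho> unfolding z'
    by (simp add: inner_simps inner_commute field_simps)
  then show ?thesis
    using 1 2 3 d by simp
qed

section \<open>Invariants of a run and the one-step estimate\<close>

text \<open>After each sweep \<open>\<zeta>\<close> repeats the mean of the components of
  \<open>\<eta>\<close>, so the deviations sum to zero and the update keeps \<open>w\<close> in
  \<open>W_space\<close>. At index 0 the facts come from the initialization.\<close>

lemma ADA_invariants:
  assumes run: "ADA \<rho> c blk X f E w x \<eta> \<zeta> y"
  shows "w \<nu> \<in> W_space" "\<zeta> \<nu> \<in> W_perp" "\<eta> (Suc \<nu>) - \<zeta> (Suc \<nu>) \<in> W_space"
    "y \<nu> = (1 / 2) *\<^sub>R (\<eta> \<nu> + \<zeta> \<nu>)"
    "w (Suc \<nu>) = w \<nu> + (1 / \<rho>) *\<^sub>R (\<eta> (Suc \<nu>) - \<zeta> (Suc \<nu>))"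
proof -
  have diff: "\<eta> (Suc \<nu>) - \<zeta> (Suc \<nu>) \<in> W_space" for \<nu>
    using run by (simp add: ADA_def W_space_def sum_subtractf sum_constant_scaleR del: sum_constant)
  have w_Suc: "w (Suc \<nu>) = w \<nu> + (1 / \<rho>) *\<^sub>R (\<eta> (Suc \<nu>) - \<zeta> (Suc \<nu>))" for \<nu>
    using run by (simp add: ADA_def vec_eq_iff)
  show "w \<nu> \<in> W_space"
  proof (induction \<nu>)
    case 0
    then show ?case
      using run by (simp add: ADA_def)
  next
    case (Suc \<nu>)
    then show ?case
      unfolding w_Suc
      by (intro subspace_add subspace_scale subspace_W_space diff)
  qed
  show "\<zeta> \<nu> \<in> W_perp"
    using run by (cases \<nu>) (auto simp: ADA_def S_space_def W_perp_def)
  show "y \<nu> = (1 / 2) *\<^sub>R (\<eta> \<nu> + \<zeta> \<nu>)"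
    using run by (cases \<nu>) (auto simp: ADA_def vec_eq_iff)
  show "\<eta> (Suc \<nu>) - \<zeta> (Suc \<nu>) \<in> W_space"
    "w (Suc \<nu>) = w \<nu> + (1 / \<rho>) *\<^sub>R (\<eta> (Suc \<nu>) - \<zeta> (Suc \<nu>))"
    by (fact diff w_Suc)+
qed

text \<open>The multiplier update solved for the block images, with \<open>y\<close> eliminated;
  this is the form of \<open>z\<close> that \<open>coupling_term_eq\<close> expects.\<close>

lemma ADA_block_images:
  assumes "ADA \<rho> c blk X f E w x \<eta> \<zeta> y" "\<rho> > 0"
  shows "block_images blk E (x (Suc \<nu>))
    = w \<nu> + (1 / \<rho>) *\<^sub>R (2 *\<^sub>R \<eta> (Suc \<nu>) - \<eta> \<nu> - \<zeta> \<nu>)"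
proof -
  have "\<eta> (Suc \<nu>) = (1 / 2) *\<^sub>R (\<eta> \<nu> + \<zeta> \<nu>)
      + (1 / 2) *\<^sub>R \<rho> *\<^sub>R (block_images blk E (x (Suc \<nu>)) - w \<nu>)"
    unfolding ADA_invariants(4)[OF assms(1), symmetric]
    using assms(1) by (simp add: ADA_def vec_eq_iff block_images_def)
  then have "2 *\<^sub>R \<eta> (Suc \<nu>) - \<eta> \<nu> - \<zeta> \<nu> = \<rho> *\<^sub>R (block_images blk E (x (Suc \<nu>)) - w \<nu>)"
    by (simp only: scaleR_add_right scaleR_scaleR) simp
  then show ?thesis
    using assms(2) by simp
qed

text \<open>The penalty terms are real, so comparing the minimizer with \<open>v\<close> excludes
  the value infinity.\<close>

lemma ADA_block_finite:
  assumes run: "ADA \<rho> c blk X f E w x \<eta> \<zeta> y"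
    and "f k (block blk k (x (Suc \<nu>))) \<noteq> -\<infinity>" "v \<in> X k" "f k v = ereal s"
  shows "f k (block blk k (x (Suc \<nu>))) = ereal (real_of_ereal (f k (block blk k (x (Suc \<nu>)))))"
proof -
  define Q where "Q z = f k z
      + ereal (\<rho> / 4 * (norm (E *v z - w \<nu> $ k + (2 / \<rho>) *\<^sub>R y \<nu> $ k))\<^sup>2)
      + ereal (1 / (2 * c) * (norm (z - block blk k (x \<nu>)))\<^sup>2)" for z
  have "is_arg_min Q (\<lambda>z. z \<in> X k) (block blk k (x (Suc \<nu>)))"
    using run unfolding ADA_def Q_def by blast
  then have "Q (block blk k (x (Suc \<nu>))) \<le> Q v"
    using assms(3) by (auto simp: is_arg_min_def not_less)
  also have "\<dots> < \<infinity>"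
    by (simp add: Q_def assms(4))
  finally have "f k (block blk k (x (Suc \<nu>))) \<noteq> \<infinity>"
    by (auto simp: Q_def)
  then show ?thesis
    using assms(2) by (cases "f k (block blk k (x (Suc \<nu>)))") auto
qed

lemma ADA_step:
  fixes blk :: "'n::finite \<Rightarrow> 'k::finite" and E :: "real ^ 'n ^ 'm::finite"
  assumes f: "\<And>k. convex (ereal_epigraph (block_space blk k) (f k))"
    and X: "\<And>k. X k \<subseteq> block_space blk k" "\<And>k. convex (X k)"
    and pos: "\<rho> > 0" "c > 0"
    and run: "ADA \<rho> c blk X f E w x \<eta> \<zeta> y"
    and x': "x' \<in> block_product blk X" "\<And>k. f k (block blk k x') = ereal (s k)"
    and x\<^sub>1: "\<And>k. f k (block blk k (x (Suc \<nu>))) = ereal (r k)"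
    and w': "w' = block_images blk E x'" "w' \<in> W_space"
    and \<eta>': "\<eta>' \<in> W_perp"
  shows "(\<Sum>k\<in>UNIV. r k) + \<eta>' \<bullet> block_images blk E (x (Suc \<nu>)) - (\<Sum>k\<in>UNIV. s k)
    \<le> (G_norm_sq \<rho> c ((w', x', \<eta>', \<eta>') - (w \<nu>, x \<nu>, \<eta> \<nu>, \<zeta> \<nu>))
       - G_norm_sq \<rho> c ((w', x', \<eta>', \<eta>')
           - (w (Suc \<nu>), x (Suc \<nu>), \<eta> (Suc \<nu>), \<zeta> (Suc \<nu>)))) / 2"
proof -
  define z where "z = block_images blk E (x (Suc \<nu>))"
  have "r k \<le> s k + (w' - z) $ k \<bullet> \<eta> (Suc \<nu>) $ k
      + 1 / c * (block blk k (x' - x (Suc \<nu>)) \<bullet> block blk k (x (Suc \<nu>) - x \<nu>))" for k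
  proof -
    \<comment> \<open>The shift \<open>?a\<close> absorbs \<open>w\<close> and \<open>y\<close>,
      giving the quadratic the form required by the proximal inequality.\<close>
    let ?p = "block blk k (x (Suc \<nu>))" and ?a = "w \<nu> $ k - (2 / \<rho>) *\<^sub>R y \<nu> $ k"
    have "is_arg_min (\<lambda>v. f k v + ereal (\<rho> / 4 * (norm (E *v v - ?a))\<^sup>2)
        + ereal (1 / (2 * c) * (norm (v - block blk k (x \<nu>)))\<^sup>2)) (\<lambda>v. v \<in> X k) ?p"
      using run unfolding ADA_def by (simp add: algebra_simps)
    moreover have "block blk k x' \<in> X k"
      using x' by (simp add: block_product_def)
    ultimately have "r k \<le> s k
        + 2 * (\<rho> / 4) * ((E *v block blk k x' - E *v ?p) \<bullet> (E *v ?p - ?a))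
        + 2 * (1 / (2 * c)) * ((block blk k x' - ?p) \<bullet> (?p - block blk k (x \<nu>)))"
      by (intro proximal_variational_inequality[OF f X(2) X(1)]) (use x' x\<^sub>1 in auto)
    \<comment> \<open>The factor \<open>2 * (\<rho> / 4)\<close> from the proximal inequality turns
      the residual into exactly the new multiplier.\<close>
    moreover have "\<eta> (Suc \<nu>) $ k = (\<rho> / 2) *\<^sub>R (E *v ?p - ?a)"
      using run pos by (simp add: ADA_def algebra_simps)
    ultimately show ?thesis
      by (simp add: w' z_def block_images_def linear_diff[OF linear_block])
  qed
  then have "(\<Sum>k\<in>UNIV. r k) \<le> (\<Sum>k\<in>UNIV. s k + (w' - z) $ k \<bullet> \<eta> (Suc \<nu>) $ k
      + 1 / c * (block blk k (x' - x (Suc \<nu>)) \<bullet> block blk k (x (Suc \<nu>) - x \<nu>)))"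
    by (rule sum_mono)
  also have "\<dots> = (\<Sum>k\<in>UNIV. s k) + (w' - z) \<bullet> \<eta> (Suc \<nu>)
      + 1 / c * ((x' - x (Suc \<nu>)) \<bullet> (x (Suc \<nu>) - x \<nu>))"
    unfolding sum.distrib sum_distrib_left[symmetric] sum_inner_block
    by (simp add: inner_vec_def)
  finally have "(\<Sum>k\<in>UNIV. r k) + \<eta>' \<bullet> z - (\<Sum>k\<in>UNIV. s k)
      \<le> ((w' - z) \<bullet> \<eta> (Suc \<nu>) + \<eta>' \<bullet> z)
        + 1 / c * ((x' - x (Suc \<nu>)) \<bullet> (x (Suc \<nu>) - x \<nu>))"
    by simp
  also have "(w' - z) \<bullet> \<eta> (Suc \<nu>) + \<eta>' \<bullet> z = \<rho> * ((w' - w (Suc \<nu>)) \<bullet> (w (Suc \<nu>) - w \<nu>))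
      + 1 / \<rho> * ((\<eta>' - \<eta> (Suc \<nu>)) \<bullet> (\<eta> (Suc \<nu>) - \<eta> \<nu>))
      + 1 / \<rho> * ((\<eta>' - \<zeta> (Suc \<nu>)) \<bullet> (\<zeta> (Suc \<nu>) - \<zeta> \<nu>))"
    unfolding z_def
    using pos w' \<eta>' ADA_invariants[OF run] ADA_block_images[OF run pos(1)]
    by (intro coupling_term_eq) blast+
  \<comment> \<open>The three-point inequality is applied to each of the four components, with the
    weights of the \<open>G\<close>-norm.\<close>
  also have "\<dots> + 1 / c * ((x' - x (Suc \<nu>)) \<bullet> (x (Suc \<nu>) - x \<nu>))
      \<le> \<rho> * (((norm (w' - w \<nu>))\<^sup>2 - (norm (w' - w (Suc \<nu>)))\<^sup>2) / 2)
        + 1 / \<rho> * (((norm (\<eta>' - \<eta> \<nu>))\<^sup>2 - (norm (\<eta>' - \<eta> (Suc \<nu>)))\<^sup>2) / 2)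
        + 1 / \<rho> * (((norm (\<eta>' - \<zeta> \<nu>))\<^sup>2 - (norm (\<eta>' - \<zeta> (Suc \<nu>)))\<^sup>2) / 2)
        + 1 / c * (((norm (x' - x \<nu>))\<^sup>2 - (norm (x' - x (Suc \<nu>)))\<^sup>2) / 2)"
    using pos by (intro add_mono mult_left_mono inner_diff_le_half_norm_diff) auto
  finally show ?thesis
    by (simp add: G_norm_sq_def z_def right_diff_distrib diff_divide_distrib add_divide_distrib)
qed

section \<open>Ergodic mean and the final bound\<close>

lemma G_norm_sq_nonneg: "\<rho> > 0 \<Longrightarrow> c > 0 \<Longrightarrow> 0 \<le> G_norm_sq \<rho> c u"
  by (simp add: G_norm_sq_def split: prod.split)

text \<open>Jensen's inequality in each block with equal weights, followed by an exchange of the two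
  sums.\<close>

lemma objective_ergodic_mean_le:
  assumes f: "\<And>k. convex (ereal_epigraph (block_space blk k) (f k))"
    and r: "\<And>\<nu> k. f k (block blk k (x (Suc \<nu>))) = ereal (r \<nu> k)"
    and N: "N > 0"
  shows "objective blk f (ergodic_mean x N) \<le> ereal ((\<Sum>\<nu><N. \<Sum>k\<in>UNIV. r \<nu> k) / real N)"
proof -
  have "f k (block blk k (ergodic_mean x N)) \<le> ereal ((\<Sum>\<nu><N. r \<nu> k) / real N)" for k
  proof -
    \<comment> \<open>The mean runs over indices 1 to \<open>N\<close>; shifting it to
      \<open>\<nu> < N\<close> matches \<open>r \<nu>\<close>, which belongs to the iterate
      \<open>Suc \<nu>\<close>.\<close>
    have "block blk k (ergodic_mean x N)
        = (\<Sum>\<nu><N. (1 / real N) *\<^sub>R block blk k (x (Suc \<nu>)))"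
      by (simp add: ergodic_mean_def linear_scale[OF linear_block] linear_sum[OF linear_block]
          scaleR_sum_right sum.atLeast1_atMost_eq)
    moreover have "f k (\<Sum>\<nu><N. (1 / real N) *\<^sub>R block blk k (x (Suc \<nu>)))
        \<le> ereal (\<Sum>\<nu><N. 1 / real N * r \<nu> k)"
      using N r by (intro convex_epigraphD[OF f]) (auto simp: block_space_def block_def)
    ultimately show ?thesis
      by (simp add: sum_divide_distrib)
  qed
  then have "objective blk f (ergodic_mean x N)
      \<le> (\<Sum>k\<in>UNIV. ereal ((\<Sum>\<nu><N. r \<nu> k) / real N))"
    unfolding objective_def by (rule sum_mono)
  also have "\<dots> = ereal ((\<Sum>\<nu><N. \<Sum>k\<in>UNIV. r \<nu> k) / real N)"
    using sum.swap[of r UNIV "{..<N}"] by (simp add: sum_divide_distrib[symmetric])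
  finally show ?thesis .
qed

theorem theorem2p3:
  fixes blk :: "'n::finite \<Rightarrow> 'k::finite"
    and X :: "'k \<Rightarrow> (real ^ 'n) set"
    and f :: "'k \<Rightarrow> real ^ 'n \<Rightarrow> ereal"
    and E :: "real ^ 'n ^ 'm::finite"
    and \<rho> c :: real
    and w \<eta> \<zeta> y :: "nat \<Rightarrow> real ^ 'm ^ 'k"
    and x :: "nat \<Rightarrow> real ^ 'n"
    and w' \<eta>' \<zeta>' :: "real ^ 'm ^ 'k"
    and x' :: "real ^ 'n"
    and k\<^sub>1 :: 'k
    and N :: nat
  assumes f: "\<And>k. closed_proper_convex_on (block_space blk k) (f k)"
    and X: "\<And>k. X k \<subseteq> block_space blk k" "\<And>k. closed (X k)" "\<And>k. convex (X k)"
    and P: "standing_assumption blk X f E 0"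
    and pos: "\<rho> > 0" "c > 0"
    and run: "ADA \<rho> c blk X f E w x \<eta> \<zeta> y"
    and N: "N > 0"
    and saddle: "saddle_point blk X f E w' x' \<eta>' \<zeta>'"
  shows "objective blk f (ergodic_mean x N) + ereal (\<eta>' $ k\<^sub>1 \<bullet> (E *v ergodic_mean x N))
           - min_value blk X f E 0
         \<le> ereal (G_norm_sq \<rho> c ((w', x', \<eta>', \<zeta>') - (w 0, x 0, \<eta> 0, \<zeta> 0)) / real N)"
proof -
  have f_convex: "convex (ereal_epigraph (block_space blk k) (f k))" for k
    using f by (simp add: closed_proper_convex_on_def)
  have f_block: "f k (block blk k z) \<noteq> -\<infinity>" for k z
    using f[of k] by (auto simp: closed_proper_convex_on_def block_space_def block_def)
  define s where "s k = real_of_ereal (f k (block blk k x'))" for k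
  define r where "r \<nu> k = real_of_ereal (f k (block blk k (x (Suc \<nu>))))" for \<nu> k
  have s: "f k (block blk k x') = ereal (s k)" for k
    unfolding s_def
    using f_block saddle_point_objective_finite[OF P saddle] by (rule objective_finiteD)
  have obj: "objective blk f x' = ereal (\<Sum>k\<in>UNIV. s k)"
    by (simp add: objective_def s)
  have x': "x' \<in> block_product blk X"
    using saddle by (simp add: saddle_point_def)
  have r: "f k (block blk k (x (Suc \<nu>))) = ereal (r \<nu> k)" for \<nu> k
    unfolding r_def using f_block _ s
    by (rule ADA_block_finite[OF run]) (use x' in \<open>simp add: block_product_def\<close>)
  have w': "w' = block_images blk E x'" "w' \<in> W_space"
    using saddle_point_block_images[OF saddle obj] saddle by (simp_all add: saddle_point_def)
  have \<eta>': "\<eta>' \<in> W_perp"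
    using saddle_point_multiplier[OF saddle obj] .
  have \<zeta>': "\<zeta>' = \<eta>'"
    using saddle \<eta>' by (auto simp: saddle_point_def intro: S_space_W_perp_eq)
  \<comment> \<open>The fourth component is \<open>\<eta>'\<close> because
    \<open>\<zeta>' = \<eta>'\<close>.\<close>
  define G where "G \<nu> = G_norm_sq \<rho> c ((w', x', \<eta>', \<eta>') - (w \<nu>, x \<nu>, \<eta> \<nu>, \<zeta> \<nu>))" for \<nu>
  have G_nonneg: "0 \<le> G \<nu>" for \<nu>
    unfolding G_def using G_norm_sq_nonneg[OF pos] .
  define l where "l \<nu> = \<eta>' \<bullet> block_images blk E (x (Suc \<nu>))" for \<nu>
  have "(\<Sum>\<nu><N. (\<Sum>k\<in>UNIV. r \<nu> k) + l \<nu> - (\<Sum>k\<in>UNIV. s k))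
      \<le> (\<Sum>\<nu><N. (G \<nu> - G (Suc \<nu>)) / 2)"
    unfolding G_def l_def
    by (intro sum_mono ADA_step[OF f_convex X(1,3) pos run x' s r w' \<eta>'])
  also have "\<dots> = (G 0 - G N) / 2"
    unfolding sum_divide_distrib[symmetric] by (simp add: sum_lessThan_telescope')
  \<comment> \<open>Dropping \<open>G N\<close> and the factor 1/2 gives the constant of the stated
    bound.\<close>
  also have "\<dots> \<le> G 0"
    using G_nonneg[of 0] G_nonneg[of N] by simp
  finally have "(\<Sum>\<nu><N. \<Sum>k\<in>UNIV. r \<nu> k) + (\<Sum>\<nu><N. l \<nu>) - real N * (\<Sum>k\<in>UNIV. s k) \<le> G 0"
    by (simp add: sum.distrib sum_subtractf)
  from divide_right_mono[OF this, of "real N"] have bound: "(\<Sum>\<nu><N. \<Sum>k\<in>UNIV. r \<nu> k) / real N + (\<Sum>\<nu><N. l \<nu>) / real N - (\<Sum>k\<in>UNIV. s k)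
      \<le> G 0 / real N"
    using N by (simp add: diff_divide_distrib add_divide_distrib)
  \<comment> \<open>Membership of \<open>\<eta>'\<close> in \<open>W_perp\<close> identifies the
    pairing by a single component with the full pairing over all blocks.\<close>
  have "\<eta>' $ k\<^sub>1 \<bullet> (E *v ergodic_mean x N) = \<eta>' \<bullet> block_images blk E (ergodic_mean x N)"
    by (simp add: inner_W_perp[OF \<eta>', of _ k\<^sub>1] sum_block_images)
  also have "\<dots> = (\<Sum>\<nu><N. l \<nu>) / real N"
    by (simp add: l_def ergodic_mean_def linear_scale[OF linear_block_images]
        linear_sum[OF linear_block_images] inner_sum_right sum.atLeast1_atMost_eq)
  finally have l: "\<eta>' $ k\<^sub>1 \<bullet> (E *v ergodic_mean x N) = (\<Sum>\<nu><N. l \<nu>) / real N" .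
  have "objective blk f (ergodic_mean x N) + ereal (\<eta>' $ k\<^sub>1 \<bullet> (E *v ergodic_mean x N))
      - min_value blk X f E 0
    \<le> ereal ((\<Sum>\<nu><N. \<Sum>k\<in>UNIV. r \<nu> k) / real N) + ereal ((\<Sum>\<nu><N. l \<nu>) / real N)
      - ereal (\<Sum>k\<in>UNIV. s k)"
    unfolding l
    \<comment> \<open>The subtracted optimal value is replaced by the smaller or equal objective
      value at the saddle point.\<close>
    by (intro ereal_minus_mono add_right_mono objective_ergodic_mean_le f_convex r N
        saddle_point_objective_le_min_value[OF saddle obj])
  also have "\<dots> \<le> ereal (G 0 / real N)"
    using bound by simp
  finally show ?thesis
    by (simp add: G_def \<zeta>')
qed

end
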